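(* Let $Q\subseteq\mathbb{R}^n$ be a convex compact set and let $f:Q\to\mathbb{R}$ be an $M$-Lipschitz ($M>0$), weakly $\beta$-quasiconvex function for some $\beta\in(0,1]$, with $f^*=\min_{x\in Q}f(x)$ and $X_*=\{x_*\in Q: f(x_* )=f^*\}$. Let $\alpha>0$, $\Delta>0$ and $\overline f\ge 0$ with $\overline f\ge f^*$ be such that $$f(x)-\overline f\ \ge\ \alpha\min_{x_*\in X_*}\|x-x_*\|_2-\Delta\qquad\text{for all }x\in Q.$$ Let $x_0\in Q$ and, for $k\ge 0$, $$x_{k+1}=Pr_Q\{x_k-h_k\nabla f(x_k)\},\qquad h_k=\frac{\beta\,(f(x_k)-\overline f)}{M^2},$$ and suppose $\alpha^2\beta^2\le 2M^2$. Then for every $k\ge 0$ $$\min_{x_*\in X_*}\|x_{k+1}-x_*\|_2^2\le\left(1-\frac{\alpha^2\beta^2}{2M^2}\right)^{k+1}\min_{x_*\in X_*}\|x_0-x_*\|_2^2+\frac{2\Delta^2}{\alpha^2\beta^2}.$$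
   Context: $\|\cdot\|_2$ is the Euclidean norm, $Pr_Q$ is the Euclidean projection onto $Q$, and the solution set $X_*$ is compact (nonempty). $f$ is $M$-Lipschitz if $|f(x)-f(y)|\le M\|x-y\|_2$ for all $x,y\in Q$. $\nabla f(x)$ denotes an arbitrary element of the Clarke subdifferential of $f$ at $x$, assumed to exist (the ordinary gradient if $f$ is differentiable at $x$). It is assumed that $\|\nabla f(x_k)\|_2\ne0$ for all $k\ge0$. The function $f$ is called weakly $\beta$-quasiconvex ($\beta\in(0,1]$) with respect to a minimizer $x_*$ of $f$ on $Q$ if for every $x\in Q$ and every subgradient $\nabla f(x)$ $$f(x_* )\ge f(x)+\frac1\beta\langle\nabla f(x),x_*-x\rangle;$$ here this is required for every $x_*\in X_*$. *)

theory Defs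
  imports "HOL-Analysis.Analysis"
begin

text \<open>
  A function on \<open>Q\<close> is a total function of which only the values on \<open>Q\<close> matter.  Clarke's
  directional derivative at \<open>x\<close> in direction \<open>v\<close> is the upper limit of
  \<open>(f (y + t v) - f y) / t\<close> as \<open>y\<close> tends to \<open>x\<close> and \<open>t\<close> tends to \<open>0\<close> from above.  As \<open>f\<close> lives on
  \<open>Q\<close> only, both \<open>y\<close> and \<open>y + t v\<close> have to stay in \<open>Q\<close>; at interior points of \<open>Q\<close> this
  restriction is void and the classical notion results.
\<close>

definition clarke_filter :: "'a::euclidean_space set \<Rightarrow> 'a \<Rightarrow> 'a \<Rightarrow> ('a \<times> real) filter" where
  "clarke_filter Q x v =
     inf (nhds x \<times>\<^sub>F at_right 0) (principal {(y, t). y \<in> Q \<and> y + t *\<^sub>R v \<in> Q})"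

definition clarke_dderiv ::
  "'a::euclidean_space set \<Rightarrow> ('a \<Rightarrow> real) \<Rightarrow> 'a \<Rightarrow> 'a \<Rightarrow> ereal" where
  "clarke_dderiv Q f x v =
     Limsup (clarke_filter Q x v) (\<lambda>(y, t). ereal ((f (y + t *\<^sub>R v) - f y) / t))"

text \<open>
  The filter is trivial only if \<open>v\<close> is not parallel to the affine hull of \<open>Q\<close> (for convex \<open>Q\<close> and
  \<open>x \<in> Q\<close>).  The upper limit would then be \<open>-\<infinity>\<close>, so such directions are left out; otherwise
  the subdifferential would be empty whenever \<open>Q\<close> has empty interior.
\<close>

definition clarke_subdiff ::
  "'a::euclidean_space set \<Rightarrow> ('a \<Rightarrow> real) \<Rightarrow> 'a \<Rightarrow> 'a set" where
  "clarke_subdiff Q f x =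
     {g. \<forall>v. clarke_filter Q x v \<noteq> bot \<longrightarrow> ereal (g \<bullet> v) \<le> clarke_dderiv Q f x v}"

text \<open>
  The Clarke subdifferential can be larger than the singleton of the gradient at a point of
  differentiability; there only the gradient is admitted.
\<close>

definition subgradients ::
  "'a::euclidean_space set \<Rightarrow> ('a \<Rightarrow> real) \<Rightarrow> 'a \<Rightarrow> 'a set" where
  "subgradients Q f x =
     {g \<in> clarke_subdiff Q f x.
        f differentiable (at x within Q) \<longrightarrow> (f has_derivative (\<lambda>v. g \<bullet> v)) (at x within Q)}"

definition min_value :: "'a set \<Rightarrow> ('a \<Rightarrow> real) \<Rightarrow> real" where
  "min_value Q f = (INF x\<in>Q. f x)"

definition minimizers :: "'a set \<Rightarrow> ('a \<Rightarrow> real) \<Rightarrow> 'a set" where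
  "minimizers Q f = {x \<in> Q. f x = min_value Q f}"

definition weakly_quasiconvex ::
  "real \<Rightarrow> 'a::euclidean_space set \<Rightarrow> ('a \<Rightarrow> real) \<Rightarrow> bool" where
  "weakly_quasiconvex \<beta> Q f \<longleftrightarrow>
     (\<forall>xs \<in> minimizers Q f. \<forall>x \<in> Q. \<forall>g \<in> subgradients Q f x.
        f xs \<ge> f x + (1 / \<beta>) * (g \<bullet> (xs - x)))"

end

theory Submission imports Defs begin

text \<open>
  Write \<open>d k\<close> for the distance from \<open>x k\<close> to the solution set, \<open>q = 1 - \<alpha>\<^sup>2\<beta>\<^sup>2 / (2M\<^sup>2)\<close> and
  \<open>C = 2\<Delta>\<^sup>2 / (\<alpha>\<^sup>2\<beta>\<^sup>2)\<close>.  The bound follows by induction from the one-step estimate that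
  \<open>(d (k+1))\<^sup>2\<close> is at most \<open>q (d k)\<^sup>2 + (1 - q) C\<close> or at most \<open>C\<close>.

  A subgradient \<open>g\<close> may have norm larger than \<open>M\<close>: if \<open>Q\<close> has empty interior, its component
  orthogonal to the affine hull of \<open>Q\<close> is arbitrary.  But this component affects neither the
  projection onto \<open>Q\<close> nor the inner products with \<open>xs - x\<close> for \<open>x\<close>, \<open>xs\<close> in \<open>Q\<close>.  So \<open>g\<close> can be
  traded for its parallel component \<open>u\<close>, and \<open>norm u \<le> M\<close> because the difference quotients of
  \<open>f\<close> in direction \<open>u\<close> are at most \<open>M * norm u\<close> (\<open>subgradient_parallel_part\<close>).

  If the step size \<open>h\<close> is nonnegative, the projection does not increase distances to points
  of \<open>Q\<close>, and expanding the square and applying quasiconvexity gives a decrease of \<open>(d k)\<^sup>2\<close> by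
  at least \<open>\<beta>\<^sup>2 (f (x k) - fbar)\<^sup>2 / M\<^sup>2\<close>, where sharpness bounds \<open>(f (x k) - fbar)\<^sup>2\<close> from
  below by \<open>\<alpha>\<^sup>2 (d k)\<^sup>2 / 2 - \<Delta>\<^sup>2\<close>.  If \<open>h\<close> is negative, then the method goes uphill and
  quasiconvexity is of no help; but \<open>f (x k) < fbar\<close> forces \<open>\<alpha> d k < \<Delta>\<close>, and the step is so
  short that even the triangle inequality keeps \<open>d (k+1)\<close> at most \<open>sqrt C\<close>.
\<close>

section \<open>The part of a subgradient parallel to the affine hull\<close>

text \<open>
  Moving \<open>x\<close> slightly towards a relative interior point \<open>c\<close> gives a relative interior point
  \<open>y\<close>, from which one can go a little in every direction parallel to the affine hull without
  leaving \<open>Q\<close>.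
\<close>

lemma clarke_filter_nontrivial:
  fixes Q :: "'a::euclidean_space set"
  assumes Q: "convex Q" and x: "x \<in> Q" and v: "x + v \<in> affine hull Q"
  shows "clarke_filter Q x v \<noteq> bot"
proof
  assume "clarke_filter Q x v = bot"
  then have "\<forall>\<^sub>F (y, t) in nhds x \<times>\<^sub>F at_right (0::real). \<not> (y \<in> Q \<and> y + t *\<^sub>R v \<in> Q)"
    unfolding clarke_filter_def trivial_limit_def eventually_inf_principal
    by (simp add: case_prod_unfold)
  then obtain P R where P: "eventually P (nhds x)" and R: "eventually R (at_right (0::real))"
    and PR: "\<And>y t. P y \<Longrightarrow> R t \<Longrightarrow> \<not> (y \<in> Q \<and> y + t *\<^sub>R v \<in> Q)"
    unfolding eventually_prod_filter by auto
  obtain c where c: "c \<in> rel_interior Q"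
    using rel_interior_eq_empty[OF Q] x by blast
  have "((\<lambda>s::real. x - s *\<^sub>R (x - c)) \<longlongrightarrow> x - 0 *\<^sub>R (x - c)) (at_right 0)"
    by (intro tendsto_intros)
  then have "filterlim (\<lambda>s::real. x - s *\<^sub>R (x - c)) (nhds x) (at_right 0)"
    by simp
  from eventually_compose_filterlim[OF P this]
  have "\<forall>\<^sub>F s in at_right 0. P (x - s *\<^sub>R (x - c))" .
  moreover have "\<forall>\<^sub>F s::real in at_right 0. 0 < s \<and> s \<le> 1"
    by (rule eventually_at_rightI[of 0 1]) auto
  ultimately have "\<forall>\<^sub>F s in at_right 0. P (x - s *\<^sub>R (x - c)) \<and> 0 < s \<and> s \<le> 1"
    by (rule eventually_conj)
  then obtain s :: real where s: "P (x - s *\<^sub>R (x - c))" "0 < s" "s \<le> 1"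
    using eventually_happens'[OF trivial_limit_at_right_real] by blast
  define y where "y = x - s *\<^sub>R (x - c)"
  have y: "y \<in> rel_interior Q"
    unfolding y_def using rel_interior_convex_shrink[OF Q c x s(2,3)] .
  then have yQ: "y \<in> Q"
    using rel_interior_subset by blast
  obtain e where e: "e > 0" "ball y e \<inter> affine hull Q \<subseteq> Q"
    using y unfolding mem_rel_interior_ball by blast
  have "((\<lambda>t::real. y + t *\<^sub>R v) \<longlongrightarrow> y + 0 *\<^sub>R v) (at_right 0)"
    by (intro tendsto_intros)
  then have "((\<lambda>t::real. y + t *\<^sub>R v) \<longlongrightarrow> y) (at_right 0)"
    by simp
  then have "\<forall>\<^sub>F t in at_right 0. y + t *\<^sub>R v \<in> ball y e"
    using e(1) by (intro topological_tendstoD) auto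
  from eventually_conj[OF this R] obtain t where t: "y + t *\<^sub>R v \<in> ball y e" "R t"
    using eventually_happens'[OF trivial_limit_at_right_real] by blast
  have "y + t *\<^sub>R ((x + v) - x) \<in> affine hull Q"
    by (rule mem_affine_3_minus[OF affine_affine_hull _ v]) (use yQ x in \<open>auto simp: hull_inc\<close>)
  with e(2) t(1) have "y + t *\<^sub>R v \<in> Q"
    by auto
  with PR[OF s(1)[folded y_def] t(2)] yQ show False
    by blast
qed

lemma clarke_dderiv_le:
  fixes Q :: "'a::euclidean_space set"
  assumes f: "M-lipschitz_on Q f"
  shows "clarke_dderiv Q f x v \<le> ereal (M * norm v)"
  unfolding clarke_dderiv_def
proof (rule Limsup_bounded)
  have quotient: "(f (y + t *\<^sub>R v) - f y) / t \<le> M * norm v"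
    if "t > 0" "y \<in> Q" "y + t *\<^sub>R v \<in> Q" for y and t :: real
  proof -
    have "f (y + t *\<^sub>R v) - f y \<le> M * (t * norm v)"
      using lipschitz_onD[OF f that(3,2)] \<open>t > 0\<close> by (simp add: dist_norm)
    then show ?thesis
      using \<open>t > 0\<close> by (simp add: divide_le_eq algebra_simps)
  qed
  have "\<forall>\<^sub>F (y, t) in nhds x \<times>\<^sub>F at_right (0::real). t > 0"
    unfolding eventually_prod_filter
    by (rule exI[of _ "\<lambda>_. True"], rule exI[of _ "\<lambda>t. t > 0"])
      (auto simp: eventually_at_right_less)
  then show "\<forall>\<^sub>F p in clarke_filter Q x v.
      (case p of (y, t) \<Rightarrow> ereal ((f (y + t *\<^sub>R v) - f y) / t)) \<le> ereal (M * norm v)"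
    unfolding clarke_filter_def eventually_inf_principal
    by (rule eventually_mono) (auto intro: quotient)
qed

lemma subgradient_parallel_part:
  fixes Q :: "'a::euclidean_space set"
  assumes Q: "convex Q" and f: "M-lipschitz_on Q f" and x: "x \<in> Q"
    and g: "g \<in> subgradients Q f x"
  obtains u where "norm u \<le> M" and "\<And>a b. a \<in> Q \<Longrightarrow> b \<in> Q \<Longrightarrow> g \<bullet> (a - b) = u \<bullet> (a - b)"
proof -
  let ?L = "span ((\<lambda>a. - x + a) ` Q)"
  obtain u w where u: "u \<in> ?L" and w: "\<And>z. z \<in> ?L \<Longrightarrow> orthogonal w z" and guw: "g = u + w"
    using orthogonal_subspace_decomp_exists[of "(\<lambda>a. - x + a) ` Q" g] by metis
  have "x + u \<in> affine hull Q"
    using u affine_hull_span_gen[of x Q] x by (auto simp: hull_inc)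
  then have "ereal (g \<bullet> u) \<le> clarke_dderiv Q f x u"
    using g clarke_filter_nontrivial[OF Q x]
    unfolding subgradients_def clarke_subdiff_def by blast
  also have "\<dots> \<le> ereal (M * norm u)"
    by (rule clarke_dderiv_le[OF f])
  finally have "g \<bullet> u \<le> M * norm u"
    by simp
  moreover have "w \<bullet> u = 0"
    using w[OF u] by (simp add: orthogonal_def)
  ultimately have "norm u * norm u \<le> M * norm u"
    by (simp add: guw inner_add_left dot_square_norm power2_eq_square)
  then have "norm u \<le> M"
    using lipschitz_on_nonneg[OF f] by (cases "u = 0") auto
  moreover have "g \<bullet> (a - b) = u \<bullet> (a - b)" if "a \<in> Q" "b \<in> Q" for a b
  proof -
    have "(- x + a) - (- x + b) \<in> ?L"
      using that by (intro span_diff span_base) auto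
    then have "w \<bullet> (a - b) = 0"
      using w by (simp add: orthogonal_def)
    then show ?thesis
      by (simp add: guw inner_add_left)
  qed
  ultimately show ?thesis
    using that by blast
qed

section \<open>One step of the method\<close>

text \<open>
  Vectors with the same inner products with all differences of points of \<open>Q\<close> lead to the same
  variational inequality for the projection, so the nonexpansiveness estimate holds for \<open>u\<close>
  although the step is made along \<open>g\<close>.
\<close>

lemma norm_closest_point_step_le:
  fixes Q :: "'a::euclidean_space set"
  assumes Q: "convex Q" "closed Q" and "x \<in> Q" "a \<in> Q"
    and gu: "\<And>a b. a \<in> Q \<Longrightarrow> b \<in> Q \<Longrightarrow> g \<bullet> (a - b) = u \<bullet> (a - b)"
  shows "norm (closest_point Q (x - h *\<^sub>R g) - a) \<le> norm (x - h *\<^sub>R u - a)"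
proof -
  define y where "y = closest_point Q (x - h *\<^sub>R g)"
  have y: "y \<in> Q"
    unfolding y_def using assms by (intro closest_point_in_set) auto
  have "(x - h *\<^sub>R g - y) \<bullet> (a - y) \<le> 0"
    unfolding y_def by (rule closest_point_dot[OF Q \<open>a \<in> Q\<close>])
  then have "(x - h *\<^sub>R u - y) \<bullet> (a - y) \<le> 0"
    using gu[OF \<open>a \<in> Q\<close> y] by (simp add: inner_diff_left)
  moreover have "(norm (x - h *\<^sub>R u - a))\<^sup>2
      = (norm (x - h *\<^sub>R u - y))\<^sup>2 + (norm (y - a))\<^sup>2 - 2 * ((x - h *\<^sub>R u - y) \<bullet> (a - y))"
    by (simp add: power2_norm_eq_inner algebra_simps inner_commute)
  ultimately have "(norm (y - a))\<^sup>2 \<le> (norm (x - h *\<^sub>R u - a))\<^sup>2"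
    by (smt (verit) zero_le_power2)
  then show ?thesis
    unfolding y_def by (rule power2_le_imp_le) simp
qed

text \<open>
  Here \<open>s\<close> stands for \<open>f x - fbar\<close> and \<open>p\<close> for a minimizer nearest to \<open>x\<close>.  The step size
  \<open>\<beta> s / M\<^sup>2\<close> minimizes the quadratic bound on the new squared distance that quasiconvexity
  and \<open>norm u \<le> M\<close> give, which leaves a gain of \<open>\<beta>\<^sup>2 s\<^sup>2 / M\<^sup>2\<close>.
\<close>

lemma step_estimate_downhill:
  fixes x p u :: "'a::real_inner"
  assumes "M > 0" "norm u \<le> M" "0 < \<beta>" "\<beta> \<le> 1" "\<alpha> > 0" "s \<ge> 0"
    and quasi: "\<beta> * s \<le> u \<bullet> (x - p)"
    and sharp: "s \<ge> \<alpha> * norm (x - p) - \<Delta>"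
  shows "(norm (x - (\<beta> * s / M\<^sup>2) *\<^sub>R u - p))\<^sup>2
    \<le> (1 - \<alpha>\<^sup>2 * \<beta>\<^sup>2 / (2 * M\<^sup>2)) * (norm (x - p))\<^sup>2 + \<Delta>\<^sup>2 / M\<^sup>2"
proof -
  define d h where "d = norm (x - p)" and "h = \<beta> * s / M\<^sup>2"
  have h: "h \<ge> 0" "h * M\<^sup>2 = \<beta> * s"
    using assms by (simp_all add: h_def)
  \<comment> \<open>For \<open>\<alpha> d < \<Delta>\<close> sharpness says nothing, but then the left-hand side is not positive.\<close>
  have gain: "\<alpha>\<^sup>2 * d\<^sup>2 / 2 - \<Delta>\<^sup>2 \<le> s\<^sup>2"
  proof (cases "\<alpha> * d \<ge> \<Delta>")
    case True
    then have "(\<alpha> * d - \<Delta>)\<^sup>2 \<le> s\<^sup>2"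
      using sharp by (intro power_mono) (auto simp: d_def)
    moreover have "(\<alpha> * d - \<Delta>)\<^sup>2 - (\<alpha>\<^sup>2 * d\<^sup>2 / 2 - \<Delta>\<^sup>2) = (\<alpha> * d - 2 * \<Delta>)\<^sup>2 / 2"
      by (simp add: power2_eq_square field_simps)
    ultimately show ?thesis
      by (smt (verit) zero_le_power2 divide_nonneg_nonneg)
  next
    case False
    then have "(\<alpha> * d)\<^sup>2 \<le> \<Delta>\<^sup>2"
      using assms by (intro power_mono) (auto simp: d_def)
    then show ?thesis
      using zero_le_power2[of s] zero_le_power2[of \<Delta>] unfolding power_mult_distrib by linarith
  qed
  have "(norm (x - h *\<^sub>R u - p))\<^sup>2 = d\<^sup>2 - 2 * h * (u \<bullet> (x - p)) + h\<^sup>2 * (norm u)\<^sup>2"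
    unfolding d_def power2_norm_eq_inner
    by (simp add: power2_eq_square[of h] algebra_simps inner_commute)
  also have "\<dots> \<le> d\<^sup>2 - 2 * h * (\<beta> * s) + h\<^sup>2 * M\<^sup>2"
    using mult_left_mono[OF quasi, of "2 * h"] h(1)
      mult_left_mono[OF power_mono[OF \<open>norm u \<le> M\<close> norm_ge_zero, of 2], of "h\<^sup>2"]
    by simp
  also have "\<dots> = d\<^sup>2 - \<beta>\<^sup>2 / M\<^sup>2 * s\<^sup>2"
    using \<open>M > 0\<close> unfolding h_def by (simp add: power2_eq_square field_simps)
  also have "\<dots> \<le> d\<^sup>2 - \<beta>\<^sup>2 / M\<^sup>2 * (\<alpha>\<^sup>2 * d\<^sup>2 / 2 - \<Delta>\<^sup>2)"
    using mult_left_mono[OF gain, of "\<beta>\<^sup>2 / M\<^sup>2"] by simp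
  also have "\<dots> = (1 - \<alpha>\<^sup>2 * \<beta>\<^sup>2 / (2 * M\<^sup>2)) * d\<^sup>2 + \<beta>\<^sup>2 * \<Delta>\<^sup>2 / M\<^sup>2"
    using \<open>M > 0\<close> by (simp add: field_simps)
  also have "\<beta>\<^sup>2 * \<Delta>\<^sup>2 / M\<^sup>2 \<le> 1 * \<Delta>\<^sup>2 / M\<^sup>2"
    using assms by (intro divide_right_mono mult_right_mono power_le_one) auto
  finally show ?thesis
    unfolding d_def h_def by simp
qed

text \<open>
  The triangle inequality bounds the new distance by \<open>d + \<beta> (\<Delta> - \<alpha> d) / M\<close> with
  \<open>0 \<le> \<alpha> d \<le> \<Delta>\<close>.  This is affine in \<open>d\<close>, hence at most the larger of its values
  \<open>\<beta> \<Delta> / M\<close> and \<open>\<Delta> / \<alpha>\<close> at the ends.  Both are at most \<open>r \<Delta>\<close> with \<open>r = sqrt 2 / (\<alpha> \<beta>)\<close>, the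
  first because of \<open>\<alpha> \<beta> \<le> sqrt 2 * M\<close>, and \<open>(r \<Delta>)\<^sup>2\<close> is the asserted bound.
\<close>

lemma step_estimate_uphill:
  fixes x p u :: "'a::real_inner"
  assumes "M > 0" "norm u \<le> M" "0 < \<beta>" "\<beta> \<le> 1" "\<alpha> > 0" "s \<le> 0"
    and sharp: "s \<ge> \<alpha> * norm (x - p) - \<Delta>"
    and cond: "\<alpha>\<^sup>2 * \<beta>\<^sup>2 \<le> 2 * M\<^sup>2"
  shows "(norm (x - (\<beta> * s / M\<^sup>2) *\<^sub>R u - p))\<^sup>2 \<le> 2 * \<Delta>\<^sup>2 / (\<alpha>\<^sup>2 * \<beta>\<^sup>2)"
proof -
  define d r where "d = norm (x - p)" and "r = sqrt 2 / (\<alpha> * \<beta>)"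
  have \<Delta>: "\<alpha> * d \<le> \<Delta>" "d \<ge> 0"
    using assms by (auto simp: d_def)
  have "\<alpha> * \<beta> \<le> sqrt 2 * M"
    by (rule power2_le_imp_le) (use assms in \<open>auto simp: power_mult_distrib\<close>)
  then have "\<alpha> * \<beta> * \<beta> \<le> sqrt 2 * M * 1"
    by (rule mult_mono) (use assms in auto)
  then have start: "\<beta> / M \<le> r"
    using assms by (simp add: r_def field_simps)
  have "\<beta> \<le> sqrt 2"
    using \<open>\<beta> \<le> 1\<close> real_sqrt_ge_1_iff[of 2] by linarith
  then have finish: "1 \<le> r * \<alpha>"
    using assms by (simp add: r_def field_simps)
  have "norm ((\<beta> * s / M\<^sup>2) *\<^sub>R u) = \<beta> * - s / M\<^sup>2 * norm u"
    using assms by (simp add: abs_mult)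
  also have "\<dots> \<le> \<beta> * - s / M\<^sup>2 * M"
    using assms by (intro mult_left_mono divide_nonneg_nonneg mult_nonneg_nonneg) auto
  also have "\<dots> = \<beta> / M * - s"
    using assms by (simp add: power2_eq_square)
  also have "\<dots> \<le> \<beta> / M * (\<Delta> - \<alpha> * d)"
    using assms by (intro mult_left_mono) (auto simp: d_def)
  also have "\<dots> \<le> r * (\<Delta> - \<alpha> * d)"
    using \<Delta> start by (intro mult_right_mono) auto
  finally have "norm (x - (\<beta> * s / M\<^sup>2) *\<^sub>R u - p) \<le> d + r * (\<Delta> - \<alpha> * d)"
    using norm_triangle_ineq4[of "x - p" "(\<beta> * s / M\<^sup>2) *\<^sub>R u"]
    by (simp add: d_def algebra_simps)
  also have "\<dots> \<le> r * \<Delta>"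
    using mult_right_mono[OF finish \<open>d \<ge> 0\<close>] by (simp add: algebra_simps)
  finally have "(norm (x - (\<beta> * s / M\<^sup>2) *\<^sub>R u - p))\<^sup>2 \<le> (r * \<Delta>)\<^sup>2"
    by (rule power_mono) simp
  then show ?thesis
    by (simp add: r_def power_mult_distrib power_divide)
qed

section \<open>The solution set\<close>

lemma minimizers_compact_nonempty:
  fixes Q :: "'a::euclidean_space set"
  assumes "compact Q" "Q \<noteq> {}" "continuous_on Q f"
  shows "compact (minimizers Q f)" "minimizers Q f \<noteq> {}"
    and "\<And>x. x \<in> Q \<Longrightarrow> min_value Q f \<le> f x"
proof -
  obtain m where m: "m \<in> Q" "\<And>x. x \<in> Q \<Longrightarrow> f m \<le> f x"
    using continuous_attains_inf[OF assms] by blast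
  have "min_value Q f = f m"
    unfolding min_value_def using m by (intro cInf_eq_minimum) auto
  with m show "minimizers Q f \<noteq> {}" "\<And>x. x \<in> Q \<Longrightarrow> min_value Q f \<le> f x"
    unfolding minimizers_def by auto
  have "closed {x \<in> Q. f x = min_value Q f}"
    using assms compact_imp_closed continuous_closed_preimage_constant by blast
  then have "compact (Q \<inter> {x \<in> Q. f x = min_value Q f})"
    using assms(1) compact_Int_closed by blast
  then show "compact (minimizers Q f)"
    unfolding minimizers_def by (simp add: Int_def conj_ac)
qed

text \<open>
  The sharpness hypothesis is about an infimum of norms, the rate about an infimum of squares;
  squaring is monotone on nonnegative reals, so one point attains both.
\<close>

lemma nearest_point_attains_INF:
  fixes S :: "'a::euclidean_space set"
  assumes "closed S" "S \<noteq> {}"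
  obtains p where "p \<in> S" "(INF a\<in>S. norm (z - a)) = norm (z - p)"
    "(INF a\<in>S. (norm (z - a))\<^sup>2) = (norm (z - p))\<^sup>2"
proof -
  obtain p where p: "p \<in> S" "\<And>a. a \<in> S \<Longrightarrow> dist z p \<le> dist z a"
    using distance_attains_inf[OF assms] by metis
  then have "(INF a\<in>S. norm (z - a)) = norm (z - p)"
    "(INF a\<in>S. (norm (z - a))\<^sup>2) = (norm (z - p))\<^sup>2"
    by (intro cInf_eq_minimum; auto simp: dist_norm intro: power_mono)+
  with p(1) that show ?thesis
    by blast
qed

section \<open>Convergence\<close>

theorem mainTheorem2:
  fixes Q :: "(real ^ 'n) set" and f :: "real ^ 'n \<Rightarrow> real"
    and M \<alpha> \<beta> \<Delta> fbar :: real
    and x g :: "nat \<Rightarrow> real ^ 'n" and h :: "nat \<Rightarrow> real"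
  assumes "convex Q" and "compact Q"
    and "M > 0" and "M-lipschitz_on Q f"
    and "0 < \<beta>" and "\<beta> \<le> 1" and "weakly_quasiconvex \<beta> Q f"
    and "\<alpha> > 0" and "\<Delta> > 0" and "fbar \<ge> 0" and "fbar \<ge> min_value Q f"
    and "\<And>z. z \<in> Q \<Longrightarrow>
           f z - fbar \<ge> \<alpha> * (INF xs\<in>minimizers Q f. norm (z - xs)) - \<Delta>"
    and "x 0 \<in> Q"
    and "\<And>k. g k \<in> subgradients Q f (x k)"
    and "\<And>k. norm (g k) \<noteq> 0"
    and "\<And>k. h k = \<beta> * (f (x k) - fbar) / M\<^sup>2"
    and "\<And>k. x (Suc k) = closest_point Q (x k - h k *\<^sub>R g k)"
    and "\<alpha>\<^sup>2 * \<beta>\<^sup>2 \<le> 2 * M\<^sup>2"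
  shows "\<forall>k. (INF xs\<in>minimizers Q f. (norm (x (k + 1) - xs))\<^sup>2)
           \<le> (1 - \<alpha>\<^sup>2 * \<beta>\<^sup>2 / (2 * M\<^sup>2)) ^ (k + 1)
               * (INF xs\<in>minimizers Q f. (norm (x 0 - xs))\<^sup>2)
             + 2 * \<Delta>\<^sup>2 / (\<alpha>\<^sup>2 * \<beta>\<^sup>2)"
proof -
  define D where "D z = (INF xs\<in>minimizers Q f. (norm (z - xs))\<^sup>2)" for z
  define q C where "q = 1 - \<alpha>\<^sup>2 * \<beta>\<^sup>2 / (2 * M\<^sup>2)" and "C = 2 * \<Delta>\<^sup>2 / (\<alpha>\<^sup>2 * \<beta>\<^sup>2)"
  have q: "0 \<le> q"
    using assms(3,18) by (simp add: q_def field_simps)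
  have "C \<ge> 0"
    by (simp add: C_def)
  have qC: "\<Delta>\<^sup>2 / M\<^sup>2 = (1 - q) * C"
    using assms(3,5,8) by (simp add: q_def C_def)
  have "Q \<noteq> {}" "closed Q"
    using assms(2,13) compact_imp_closed by auto
  note min = minimizers_compact_nonempty[OF assms(2) \<open>Q \<noteq> {}\<close> lipschitz_on_continuous_on[OF assms(4)]]
  note nearest = nearest_point_attains_INF[OF compact_imp_closed[OF min(1)] min(2)]
  have xQ: "x k \<in> Q" for k
    by (cases k) (use assms(13,17) closest_point_in_set[OF \<open>closed Q\<close> \<open>Q \<noteq> {}\<close>] in auto)
  have step: "D (x (Suc k)) \<le> q * D (x k) + (1 - q) * C \<or> D (x (Suc k)) \<le> C" for k
  proof -
    obtain p where p: "p \<in> minimizers Q f"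
      and p1: "(INF xs\<in>minimizers Q f. norm (x k - xs)) = norm (x k - p)"
      and p2: "D (x k) = (norm (x k - p))\<^sup>2"
      unfolding D_def by (rule nearest)
    have pQ: "p \<in> Q" and fp: "f p = min_value Q f"
      using p by (auto simp: minimizers_def)
    obtain u where u: "norm u \<le> M" "\<And>a b. a \<in> Q \<Longrightarrow> b \<in> Q \<Longrightarrow> g k \<bullet> (a - b) = u \<bullet> (a - b)"
      using subgradient_parallel_part[OF assms(1,4) xQ assms(14)] by metis
    define s where "s = f (x k) - fbar"
    define y where "y = x k - (\<beta> * s / M\<^sup>2) *\<^sub>R u - p"
    have "D (x (Suc k)) \<le> (norm (x (Suc k) - p))\<^sup>2"
      unfolding D_def using p by (intro cINF_lower bdd_belowI[of _ 0]) auto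
    also have "\<dots> \<le> (norm y)\<^sup>2"
      using norm_closest_point_step_le[OF assms(1) \<open>closed Q\<close> xQ pQ u(2)]
      unfolding y_def s_def assms(16,17)[of k] by (intro power_mono) auto
    finally have Dy: "D (x (Suc k)) \<le> (norm y)\<^sup>2" .
    have sharp: "s \<ge> \<alpha> * norm (x k - p) - \<Delta>"
      using assms(12)[OF xQ, of k] unfolding p1 s_def .
    show ?thesis
    proof (cases "s \<ge> 0")
      case True
      have "f p \<ge> f (x k) + (1 / \<beta>) * (g k \<bullet> (p - x k))"
        using assms(7,14) p xQ unfolding weakly_quasiconvex_def by blast
      then have "\<beta> * (f (x k) - f p) \<le> g k \<bullet> (x k - p)"
        using assms(5) by (simp add: field_simps inner_diff_right)
      moreover have "\<beta> * s \<le> \<beta> * (f (x k) - f p)"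
        using assms(5,11) fp by (intro mult_left_mono) (auto simp: s_def)
      ultimately have quasi: "\<beta> * s \<le> u \<bullet> (x k - p)"
        using u(2)[OF xQ[of k] pQ] by simp
      from step_estimate_downhill[OF assms(3) u(1) assms(5,6,8) True quasi sharp] Dy
      show ?thesis
        unfolding q_def[symmetric] p2[symmetric] qC y_def by linarith
    next
      case False
      then have "s \<le> 0" by simp
      from step_estimate_uphill[OF assms(3) u(1) assms(5,6,8) this sharp assms(18)] Dy
      show ?thesis
        unfolding C_def y_def by linarith
    qed
  qed
  have D0: "D (x 0) \<ge> 0"
    unfolding D_def by (rule cINF_greatest[OF min(2)]) simp
  have "D (x k) \<le> q ^ k * D (x 0) + C" for k
  proof (induction k)
    case 0
    then show ?case using \<open>C \<ge> 0\<close> by simp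
  next
    case (Suc k)
    have "0 \<le> q ^ Suc k * D (x 0)"
      using q D0 by (intro mult_nonneg_nonneg zero_le_power)
    moreover have "q * D (x k) + (1 - q) * C \<le> q ^ Suc k * D (x 0) + C"
      using mult_left_mono[OF Suc q] by (simp add: algebra_simps)
    ultimately show ?case
      using step[of k] by linarith
  qed
  then show ?thesis
    unfolding D_def q_def C_def by blast
qed

end
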